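(* Let $\mu$ be a Borel probability measure on a compact metric space $X$ and $G$ a semigroup generated by the finite set $G_1=\{\mathrm{id}_X,f_1,\dots,f_m\}$ of continuous self-maps of $X$. Let $\alpha>0$ and let $Y\subset X$ be such that $$h^u_\mu(x,G_1)\le\alpha\quad\text{for all }x\in Y.$$ Then $h(Y,G_1,\omega)\le\alpha$ for any $\omega\in\Sigma_m^+$, and $h^A(Y,G_1)\le\alpha$.
   Context: Let $(X,d)$ be a compact metric space, $f_1,\dots,f_m:X\to X$ continuous, $f_{j_1\dots j_n}:=f_{j_1}\circ\dots\circ f_{j_n}$. $\Sigma_m^*$ is the set of finite words $C=(i_1,\dots,i_n)$, $n\ge1$, over $\{1,\dots,m\}$, with length $n(C)=|C|=n$; $\Sigma_m^+$ is the space of sequences $\omega=(\omega_0,\omega_1,\dots)$ over $\{1,\dots,m\}$. For $C=(i_1,\dots,i_n)$, $$B_n(y,C,\varepsilon)=\{z\in X: d(y,z)<\varepsilon,\ d(f_{i_k\dots i_1}(y),f_{i_k\dots i_1}(z))<\varepsilon,\ 1\le k\le n\},$$ and $B_n(y,\omega,\varepsilon)=B_n(y,(\omega_0,\dots,\omega_{n-1}),\varepsilon)$ for $\omega\in\Sigma_m^+$. Upper local amalgamated entropy of $\mu$ at $x$ (with $\log 0^{-1}=+\infty$): $$h_\mu^u(x,G_1)=\lim_{\varepsilon\to0}\liminf_{n\to\infty}\sup_{|C|=n}\frac{\log\mu(B_n(x,C,\varepsilon))^{-1}}{n}.$$ Amalgamated topological entropy $h^A(Y,G_1)$: let $M(\lambda,Y,N,\varepsilon)=\inf_\Gamma\sum_{(C,y)\in\Gamma}e^{-\lambda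 n(C)}$, the infimum over at most countable $\Gamma\subset\Sigma_m^*\times X$ with $Y\subset\bigcup_{(C,y)\in\Gamma}B_{n(C)}(y,C,\varepsilon)$ and $n(C)\ge N$ for all $(C,y)\in\Gamma$; $m(\lambda,Y,\varepsilon)=\lim_{N\to\infty}M(\lambda,Y,N,\varepsilon)$; $h^A(Y,G_1,\varepsilon)=\inf\{\lambda:m(\lambda,Y,\varepsilon)=0\}$; $h^A(Y,G_1)=\lim_{\varepsilon\to0}h^A(Y,G_1,\varepsilon)$. Topological entropy on $Y$ along $\omega$, $h(Y,G_1,\omega)$: defined by the same procedure from $M_\omega(\lambda,Y,N,\varepsilon)=\inf\sum_{y\in\Gamma}e^{-\lambda n}$, the infimum over at most countable $\Gamma\subset Y$ with integers $n=n(y)\ge N$ such that $Y\subset\bigcup_{y\in\Gamma}B_n(y,\omega,\varepsilon)$. *)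

theory Defs
  imports "HOL-Probability.Probability"
begin

text \<open>The generators are \<open>f i\<close> for \<open>i \<in> {1..m}\<close>; values of \<open>f\<close> at other indices never matter.\<close>

definition words :: "nat \<Rightarrow> nat list set" where
  "words m = {C. C \<noteq> [] \<and> set C \<subseteq> {1..m}}"

definition sequences :: "nat \<Rightarrow> (nat \<Rightarrow> nat) set" where
  "sequences m = {\<omega>. \<forall>k. \<omega> k \<in> {1..m}}"

definition word_map :: "(nat \<Rightarrow> 'a \<Rightarrow> 'a) \<Rightarrow> nat list \<Rightarrow> 'a \<Rightarrow> 'a" where
  "word_map f js = foldr (\<lambda>j g. f j \<circ> g) js id"

text \<open>\<open>B\<^sub>n(y,C,\<epsilon>)\<close>, with \<open>n = length C\<close>. The maps compared are
  \<open>f i\<^sub>k \<circ> \<dots> \<circ> f i\<^sub>1\<close> for the prefixes \<open>i\<^sub>1, \<dots>, i\<^sub>k\<close> of \<open>C\<close>, whence the reversal.\<close>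

definition bowen_ball ::
    "(nat \<Rightarrow> 'a::metric_space \<Rightarrow> 'a) \<Rightarrow> 'a \<Rightarrow> nat list \<Rightarrow> real \<Rightarrow> 'a set" where
  "bowen_ball f y C \<epsilon> =
     {z. dist y z < \<epsilon> \<and>
         (\<forall>k\<in>{1..length C}.
            dist (word_map f (rev (take k C)) y) (word_map f (rev (take k C)) z) < \<epsilon>)}"

definition seq_bowen_ball ::
    "(nat \<Rightarrow> 'a::metric_space \<Rightarrow> 'a) \<Rightarrow> nat \<Rightarrow> 'a \<Rightarrow> (nat \<Rightarrow> nat) \<Rightarrow> real \<Rightarrow> 'a set" where
  "seq_bowen_ball f n y \<omega> \<epsilon> = bowen_ball f y (map \<omega> [0..<n]) \<epsilon>"

definition log_inv :: "real \<Rightarrow> ereal" where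
  "log_inv p = (if p = 0 then \<infinity> else ereal (ln (inverse p)))"

text \<open>The term at \<open>n = 0\<close> is a junk value, which does not affect the lower limit. The limits
  \<open>\<epsilon> \<rightarrow> 0\<close> and \<open>N \<rightarrow> \<infinity>\<close> below are limits of monotone functions in a complete linear order and
  hence exist.\<close>

definition upper_local_entropy ::
    "'a::metric_space measure \<Rightarrow> nat \<Rightarrow> (nat \<Rightarrow> 'a \<Rightarrow> 'a) \<Rightarrow> 'a \<Rightarrow> ereal" where
  "upper_local_entropy \<mu> m f x =
     Lim (at_right 0) (\<lambda>\<epsilon>. liminf (\<lambda>n.
       SUP C\<in>{C \<in> words m. length C = n}.
         log_inv (measure \<mu> (bowen_ball f x C \<epsilon>)) / ereal (real n)))"

text \<open>The passage from the outer quantities \<open>M(\<lambda>,N,\<epsilon>)\<close> to the entropy, common to both notions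
  of topological entropy.\<close>

definition critical_exponent :: "(real \<Rightarrow> nat \<Rightarrow> real \<Rightarrow> ennreal) \<Rightarrow> real \<Rightarrow> ereal" where
  "critical_exponent M \<epsilon> = Inf {ereal l | l. lim (\<lambda>N. M l N \<epsilon>) = 0}"

definition entropy_of :: "(real \<Rightarrow> nat \<Rightarrow> real \<Rightarrow> ennreal) \<Rightarrow> ereal" where
  "entropy_of M = Lim (at_right 0) (critical_exponent M)"

definition M_amalgamated ::
    "nat \<Rightarrow> (nat \<Rightarrow> 'a::metric_space \<Rightarrow> 'a) \<Rightarrow> 'a set \<Rightarrow> real \<Rightarrow> nat \<Rightarrow> real \<Rightarrow> ennreal" where
  "M_amalgamated m f Y l N \<epsilon> =
     Inf {(\<Sum>\<^sub>\<infinity>(C, y)\<in>\<Gamma>. ennreal (exp (- l * real (length C)))) | \<Gamma>.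
            countable \<Gamma> \<and> \<Gamma> \<subseteq> words m \<times> UNIV \<and>
            Y \<subseteq> (\<Union>(C, y)\<in>\<Gamma>. bowen_ball f y C \<epsilon>) \<and>
            (\<forall>(C, y)\<in>\<Gamma>. length C \<ge> N)}"

definition amalgamated_entropy ::
    "nat \<Rightarrow> (nat \<Rightarrow> 'a::metric_space \<Rightarrow> 'a) \<Rightarrow> 'a set \<Rightarrow> ereal" where
  "amalgamated_entropy m f Y = entropy_of (M_amalgamated m f Y)"

definition M_along ::
    "(nat \<Rightarrow> 'a::metric_space \<Rightarrow> 'a) \<Rightarrow> (nat \<Rightarrow> nat) \<Rightarrow> 'a set \<Rightarrow> real \<Rightarrow> nat \<Rightarrow> real \<Rightarrow> ennreal" where
  "M_along f \<omega> Y l N \<epsilon> =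
     Inf {(\<Sum>\<^sub>\<infinity>y\<in>\<Gamma>. ennreal (exp (- l * real (n y)))) | \<Gamma> n.
            countable \<Gamma> \<and> \<Gamma> \<subseteq> Y \<and> (\<forall>y\<in>\<Gamma>. n y \<ge> N) \<and>
            Y \<subseteq> (\<Union>y\<in>\<Gamma>. seq_bowen_ball f (n y) y \<omega> \<epsilon>)}"

definition entropy_along ::
    "(nat \<Rightarrow> 'a::metric_space \<Rightarrow> 'a) \<Rightarrow> (nat \<Rightarrow> nat) \<Rightarrow> 'a set \<Rightarrow> ereal" where
  "entropy_along f \<omega> Y = entropy_of (M_along f \<omega> Y)"

end

theory Submission
  imports Defs
begin

text \<open>Fix \<open>\<epsilon> > 0\<close> and \<open>\<alpha> < s < \<lambda>\<close>. Every \<open>x \<in> Y\<close> has arbitrarily large times \<open>n\<close> at which all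
  Bowen balls of order \<open>n\<close> and radius \<open>\<epsilon>/2\<close> around \<open>x\<close> have measure at least \<open>e\<^sup>-\<^sup>s\<^sup>n\<close>. Sort the points of
  \<open>Y\<close> by the first such time \<open>n \<ge> N\<close>. Within one class, a maximal family of pairwise disjoint
  balls along \<open>\<omega>\<close> has at most \<open>e\<^sup>s\<^sup>n\<close> members, and doubling the radii makes it cover the class; so the
  total cost is at most the tail from \<open>N\<close> of the geometric series of ratio \<open>e\<^sup>s\<^sup>-\<^sup>\<lambda>\<close>. A cover along
  a constant sequence is also an amalgamated cover, which gives the second claim.\<close>

section \<open>Bowen balls: openness and doubling of the radius\<close>

lemma word_map_simps [simp]:
  "word_map f [] = id"
  "word_map f (j # js) = f j \<circ> word_map f js"
  by (simp_all add: word_map_def)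

lemma continuous_on_word_map:
  fixes f :: "nat \<Rightarrow> 'a::metric_space \<Rightarrow> 'a"
  assumes "\<And>i. i \<in> I \<Longrightarrow> continuous_on UNIV (f i)" and "set js \<subseteq> I"
  shows "continuous_on UNIV (word_map f js)"
  using assms(2)
proof (induction js)
  case (Cons j js)
  then show ?case
    using assms(1)[of j] by (auto simp del: comp_apply simp: o_def intro: continuous_on_compose2)
qed (simp add: continuous_on_id')

text \<open>A finite intersection of preimages of open balls under continuous word maps. Its use is
  measurability: Bowen balls are Borel, so monotonicity and additivity of the measure apply to
  them.\<close>

lemma open_bowen_ball:
  fixes f :: "nat \<Rightarrow> 'a::metric_space \<Rightarrow> 'a"
  assumes "\<And>i. i \<in> I \<Longrightarrow> continuous_on UNIV (f i)" and "set C \<subseteq> I"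
  shows "open (bowen_ball f y C \<epsilon>)"
proof -
  have "bowen_ball f y C \<epsilon> = ball y \<epsilon> \<inter>
    (\<Inter>k\<in>{1..length C}. word_map f (rev (take k C)) -` ball (word_map f (rev (take k C)) y) \<epsilon>)"
    by (auto simp: bowen_ball_def)
  moreover have "open (word_map f (rev (take k C)) -` ball z \<epsilon>)" for k z
  proof (rule open_vimage)
    show "continuous_on UNIV (word_map f (rev (take k C)))"
      using assms set_take_subset[of k C]
      by (intro continuous_on_word_map[of I]) auto
  qed simp
  ultimately show ?thesis by (simp only:) (intro open_Int open_INT; simp)
qed

lemma bowen_ball_mono: "\<epsilon> \<le> \<epsilon>' \<Longrightarrow> bowen_ball f y C \<epsilon> \<subseteq> bowen_ball f y C \<epsilon>'"
  by (force simp: bowen_ball_def)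

text \<open>A common point lies within \<epsilon>/2 of both centres along every prefix of
  \<open>C\<close>. This is the doubling of radii that turns a maximal disjoint family into a
  cover.\<close>

lemma bowen_ball_of_half_meet:
  assumes "bowen_ball f x C (\<epsilon>/2) \<inter> bowen_ball f y C (\<epsilon>/2) \<noteq> {}"
  shows "x \<in> bowen_ball f y C \<epsilon>"
proof -
  have triangle: "dist b a < \<epsilon>" if "dist a c < \<epsilon>/2" "dist b c < \<epsilon>/2" for a b c :: 'a
    using that dist_triangle2[of b a c] by linarith
  show ?thesis using assms triangle unfolding bowen_ball_def by blast
qed

section \<open>Logarithms, one-sided limits and the critical exponent\<close>

lemma log_inv_antimono: "0 \<le> p \<Longrightarrow> p \<le> q \<Longrightarrow> log_inv q \<le> log_inv p"
  by (auto simp: log_inv_def)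

lemma log_inv_div_le_imp:
  assumes "log_inv p / ereal (real n) \<le> ereal s" and "0 \<le> p" and "n > 0"
  shows "exp (- s * real n) \<le> p"
proof -
  \<comment> \<open>The convention \<open>log_inv 0 = \<infinity>\<close> matters here:
    \<open>p = 0\<close> would make the quotient infinite, above any real \<open>s\<close>.\<close>
  have p: "p > 0"
    using assms by (cases "p = 0") (auto simp: log_inv_def)
  then have "- ln p / real n \<le> s"
    using assms by (simp add: log_inv_def ln_inverse)
  then have "- s * real n \<le> ln p"
    using assms(3) by (simp add: field_simps)
  then show ?thesis
    using p by (metis exp_le_cancel_iff exp_ln)
qed

text \<open>\<open>Lim\<close> is a definite description, so its value is usable only once
  convergence is known; monotonicity supplies it, the values increasing as \<epsilon> decreases to
  0.\<close>

lemma Lim_at_right_0_antimono: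
  fixes g :: "real \<Rightarrow> ereal"
  assumes anti: "\<And>a b. 0 < a \<Longrightarrow> a \<le> b \<Longrightarrow> g b \<le> g a"
  shows "Lim (at_right 0) g = (SUP \<epsilon>\<in>{0<..}. g \<epsilon>)"
proof (rule tendsto_Lim)
  show "(g \<longlongrightarrow> (SUP \<epsilon>\<in>{0<..}. g \<epsilon>)) (at_right 0)"
  proof (rule order_tendstoI)
    fix a assume "a < (SUP \<epsilon>\<in>{0<..}. g \<epsilon>)"
    then obtain e where e: "e > 0" "a < g e" by (auto simp: less_SUP_iff)
    have "\<forall>\<^sub>F x in at_right 0. x \<in> {0<..<e}"
      using e(1) by (rule eventually_at_right_real)
    then show "\<forall>\<^sub>F x in at_right 0. a < g x"
      by eventually_elim (use e anti in \<open>force intro: less_le_trans\<close>)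
  next
    fix a assume a: "(SUP \<epsilon>\<in>{0<..}. g \<epsilon>) < a"
    have "\<forall>\<^sub>F x in at_right 0. x \<in> {0<..<1::real}"
      by (rule eventually_at_right_real) simp
    then show "\<forall>\<^sub>F x in at_right 0. g x < a"
      by eventually_elim (use a in \<open>auto intro: le_less_trans[OF SUP_upper]\<close>)
  qed
qed simp

text \<open>Monotonicity in \<open>N\<close> turns \<open>lim\<close> into a supremum, and
  antitonicity in \<epsilon> passes to the critical exponent, so the outer limit is a supremum too.
  It remains to bound each critical exponent, and \<open>zero\<close> puts every real above \<alpha>
  into the set whose infimum it is.\<close>

lemma entropy_of_le:
  assumes mono_N: "\<And>l N N' \<epsilon>. N \<le> N' \<Longrightarrow> M l N \<epsilon> \<le> M l N' \<epsilon>"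
    and anti_eps: "\<And>l N \<epsilon> \<epsilon>'. \<epsilon> \<le> \<epsilon>' \<Longrightarrow> M l N \<epsilon>' \<le> M l N \<epsilon>"
    and zero: "\<And>l \<epsilon>. \<alpha> < l \<Longrightarrow> 0 < \<epsilon> \<Longrightarrow> (\<lambda>N. M l N \<epsilon>) \<longlonglongrightarrow> 0"
  shows "entropy_of M \<le> ereal \<alpha>"
proof -
  have lim: "lim (\<lambda>N. M l N \<epsilon>) = (SUP N. M l N \<epsilon>)" for l \<epsilon>
    by (intro limI LIMSEQ_SUP) (simp add: incseq_def mono_N)
  have "critical_exponent M b \<le> critical_exponent M a" if "a \<le> b" for a b
  proof -
    have "lim (\<lambda>N. M l N b) = 0" if "lim (\<lambda>N. M l N a) = 0" for l
    proof -
      have "lim (\<lambda>N. M l N b) \<le> lim (\<lambda>N. M l N a)"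
        unfolding lim using \<open>a \<le> b\<close> by (intro SUP_mono') (rule anti_eps)
      then show ?thesis using that by simp
    qed
    then show ?thesis
      unfolding critical_exponent_def by (intro Inf_superset_mono) auto
  qed
  moreover have "critical_exponent M \<epsilon> \<le> ereal \<alpha>" if "\<epsilon> > 0" for \<epsilon>
  proof (rule ereal_le_epsilon2)
    fix d :: real assume "d > 0"
    then have "lim (\<lambda>N. M (\<alpha> + d) N \<epsilon>) = 0"
      using zero[of "\<alpha> + d" \<epsilon>] that by (intro limI) simp
    then show "critical_exponent M \<epsilon> \<le> ereal \<alpha> + ereal d"
      unfolding critical_exponent_def by (intro Inf_lower) auto
  qed
  ultimately show ?thesis
    unfolding entropy_of_def by (subst Lim_at_right_0_antimono) (auto intro: SUP_least)
qed

section \<open>Disjoint families of large sets and the cost of a levelled cover\<close>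

text \<open>Disjoint events of probability at least \<open>c\<close> number at most
  \<open>1 / c\<close>, so a disjoint subfamily of greatest cardinality exists. A set meeting none
  of its members could be added to it.\<close>

lemma (in prob_space) ex_maximal_disjoint_subfamily:
  assumes meas: "\<And>x. x \<in> A \<Longrightarrow> B x \<in> events"
    and large: "\<And>x. x \<in> A \<Longrightarrow> c \<le> prob (B x)" and "c > 0"
  shows "\<exists>E. finite E \<and> E \<subseteq> A \<and> real (card E) * c \<le> 1 \<and>
    (\<forall>x\<in>A. \<exists>y\<in>E. B x \<inter> B y \<noteq> {})"
proof -
  define P where "P E \<longleftrightarrow> finite E \<and> E \<subseteq> A \<and> disjoint_family_on B E" for E
  have bound: "real (card E) * c \<le> 1" if "P E" for E
  proof -
    have "real (card E) * c \<le> (\<Sum>x\<in>E. prob (B x))"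
      using sum_mono[of E "\<lambda>_. c" "\<lambda>x. prob (B x)"] that large by (auto simp: P_def)
    also have "\<dots> = prob (\<Union>x\<in>E. B x)"
      using that meas by (intro finite_measure_finite_Union[symmetric]) (auto simp: P_def)
    also have "\<dots> \<le> 1" by simp
    finally show ?thesis .
  qed
  have "card E < Suc (nat \<lfloor>1 / c\<rfloor>)" if "P E" for E
    using bound[OF that] \<open>c > 0\<close> by (simp add: field_simps less_Suc_eq_le le_nat_floor)
  moreover have "P {}" by (simp add: P_def disjoint_family_on_def)
  ultimately obtain E where E: "P E" "\<And>F. P F \<Longrightarrow> card F \<le> card E"
    using ex_has_greatest_nat[of P "{}" card "Suc (nat \<lfloor>1 / c\<rfloor>)"] by (metis less_imp_le)
  show ?thesis
  proof (intro exI[of _ E] conjI ballI)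
    fix x assume x: "x \<in> A"
    show "\<exists>y\<in>E. B x \<inter> B y \<noteq> {}"
    proof (rule ccontr)
      assume *: "\<not> ?thesis"
      \<comment> \<open>Positive probability makes \<open>B x\<close> nonempty; hence
        \<open>x \<in> E\<close> would let \<open>B x\<close> meet itself, against
        \<open>*\<close>.\<close>
      have "B x \<noteq> {}" using large[OF x] \<open>c > 0\<close> by auto
      with * have "x \<notin> E" by auto
      moreover have "P (insert x E)"
        using E(1) x * \<open>x \<notin> E\<close> by (auto simp: P_def disjoint_family_on_insert)
      ultimately show False using E(2)[of "insert x E"] E(1) by (simp add: P_def)
    qed
  qed (use E(1) bound in \<open>auto simp: P_def\<close>)
qed

text \<open>Level \<open>k\<close> holds at most \<open>exp (s * k)\<close> points of cost
  \<open>exp (- l * k)\<close> each, hence contributes at most \<open>r ^ k\<close> with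
  \<open>r = exp (s - l) < 1\<close>. For nonnegative terms it is enough to bound the finite partial
  sums uniformly.\<close>

lemma infsum_levels_le:
  fixes n :: "'a \<Rightarrow> nat"
  assumes fin: "\<And>k. finite (E k)"
    and card: "\<And>k. real (card (E k)) * exp (- s * real k) \<le> 1"
    and G: "\<And>y. y \<in> \<Gamma> \<Longrightarrow> y \<in> E (n y) \<and> N \<le> n y" and "s < l"
  shows "(\<Sum>\<^sub>\<infinity>y\<in>\<Gamma>. ennreal (exp (- l * real (n y))))
    \<le> ennreal (exp (s - l) ^ N / (1 - exp (s - l)))"
proof (rule infsum_le_finite_sums)
  fix F assume F: "finite F" "F \<subseteq> \<Gamma>"
  define r where "r = exp (s - l)"
  have r: "0 < r" "r < 1" using \<open>s < l\<close> by (auto simp: r_def)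
  \<comment> \<open>Inserting \<open>N\<close> keeps the maximum meaningful for empty
    \<open>F\<close> and gives \<open>N \<le> K\<close>.\<close>
  define K where "K = Max (insert N (n ` F))"
  have K: "n ` F \<subseteq> {N..K}" and "N \<le> K"
    using F G by (auto simp: K_def)
  have "(\<Sum>y\<in>F. exp (- l * real (n y))) = (\<Sum>k\<in>{N..K}. \<Sum>y\<in>{y\<in>F. n y = k}. exp (- l * real (n y)))"
    using F K by (intro sum.group[symmetric]) auto
  also have "\<dots> \<le> (\<Sum>k\<in>{N..K}. r ^ k)"
  proof (rule sum_mono)
    fix k
    have "card {y\<in>F. n y = k} \<le> card (E k)"
      using F G fin by (intro card_mono) auto
    then have "(\<Sum>y\<in>{y\<in>F. n y = k}. exp (- l * real (n y))) \<le> real (card (E k)) * exp (- l * real k)"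
      by simp
    also have "\<dots> = (real (card (E k)) * exp (- s * real k)) * r ^ k"
      by (simp add: r_def exp_of_nat_mult[symmetric] mult_exp_exp algebra_simps)
    also have "\<dots> \<le> 1 * r ^ k" using card r by (intro mult_right_mono) auto
    finally show "(\<Sum>y\<in>{y\<in>F. n y = k}. exp (- l * real (n y))) \<le> r ^ k" by simp
  qed
  also have "\<dots> = (r ^ N - r ^ Suc K) / (1 - r)"
    using sum_gp_multiplied[OF \<open>N \<le> K\<close>, of r] r by (simp add: eq_divide_eq mult.commute)
  also have "\<dots> \<le> r ^ N / (1 - r)" using r by (intro divide_right_mono) auto
  finally show "(\<Sum>y\<in>F. ennreal (exp (- l * real (n y)))) \<le> ennreal (exp (s - l) ^ N / (1 - exp (s - l)))"
    by (simp add: r_def sum_ennreal ennreal_leI)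
qed (simp add: nonneg_summable_on_complete)

section \<open>Monotonicity and comparison of the two covering costs\<close>

lemma M_along_mono_N:
  assumes "N \<le> N'"
  shows "M_along f \<omega> Y l N \<epsilon> \<le> M_along f \<omega> Y l N' \<epsilon>"
  unfolding M_along_def
  by (rule Inf_superset_mono, rule Collect_mono, intro impI, elim exE conjE, intro exI conjI)
    (assumption+, use assms in force, assumption)

lemma M_along_antimono_eps:
  assumes "\<epsilon> \<le> \<epsilon>'"
  shows "M_along f \<omega> Y l N \<epsilon>' \<le> M_along f \<omega> Y l N \<epsilon>"
  unfolding M_along_def seq_bowen_ball_def
  by (rule Inf_superset_mono, rule Collect_mono, intro impI, elim exE conjE, intro exI conjI)
    (assumption+, erule order_trans, rule UN_mono[OF order_refl], rule bowen_ball_mono[OF assms])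

lemma M_amalgamated_mono_N:
  assumes "N \<le> N'"
  shows "M_amalgamated m f Y l N \<epsilon> \<le> M_amalgamated m f Y l N' \<epsilon>"
  unfolding M_amalgamated_def
  by (rule Inf_superset_mono, rule Collect_mono, intro impI, elim exE conjE, intro exI conjI)
    (assumption+, use assms in force)

lemma M_amalgamated_antimono_eps:
  assumes "\<epsilon> \<le> \<epsilon>'"
  shows "M_amalgamated m f Y l N \<epsilon>' \<le> M_amalgamated m f Y l N \<epsilon>"
  unfolding M_amalgamated_def case_prod_beta
  by (rule Inf_superset_mono, rule Collect_mono, intro impI, elim exE conjE, intro exI conjI)
    (assumption+, erule order_trans, rule UN_mono[OF order_refl], rule bowen_ball_mono[OF assms], assumption)

text \<open>Each centre \<open>y\<close> is paired with the first \<open>n y\<close> letters of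
  \<omega>, which keeps balls and costs. \<open>N \<ge> 1\<close> is what makes these words
  nonempty, hence members of \<open>words m\<close>.\<close>

lemma M_amalgamated_le_M_along:
  assumes "\<omega> \<in> sequences m" and "N \<ge> 1"
  shows "M_amalgamated m f Y l N \<epsilon> \<le> M_along f \<omega> Y l N \<epsilon>"
  unfolding M_along_def
proof (rule Inf_greatest, clarify)
  fix \<Gamma> n assume G: "countable \<Gamma>" "\<Gamma> \<subseteq> Y" "\<forall>y\<in>\<Gamma>. N \<le> n y"
    "Y \<subseteq> (\<Union>y\<in>\<Gamma>. seq_bowen_ball f (n y) y \<omega> \<epsilon>)"
  define w where "w y = (map \<omega> [0..<n y], y)" for y
  have "inj_on w \<Gamma>" by (auto simp: w_def inj_on_def)
  then have "(\<Sum>\<^sub>\<infinity>y\<in>\<Gamma>. ennreal (exp (- l * real (n y)))) =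
      (\<Sum>\<^sub>\<infinity>(C, y)\<in>w ` \<Gamma>. ennreal (exp (- l * real (length C))))"
    by (subst infsum_reindex) (auto simp: w_def o_def)
  moreover have "w ` \<Gamma> \<subseteq> words m \<times> UNIV" "\<forall>(C, y)\<in>w ` \<Gamma>. N \<le> length C"
    using assms G(3) by (fastforce simp: w_def words_def sequences_def)+
  moreover have "Y \<subseteq> (\<Union>(C, y)\<in>w ` \<Gamma>. bowen_ball f y C \<epsilon>)"
    using G(4) by (simp add: w_def seq_bowen_ball_def)
  ultimately show "M_amalgamated m f Y l N \<epsilon> \<le> (\<Sum>\<^sub>\<infinity>y\<in>\<Gamma>. ennreal (exp (- l * real (n y))))"
    unfolding M_amalgamated_def using G(1) by (intro Inf_lower) blast
qed

section \<open>From local entropy to covers of small cost\<close>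

text \<open>A lower limit below \<open>s\<close> yields arbitrarily late \<open>n\<close> with value
  below \<open>s\<close>. Since the supremum over words sits inside the lower limit, one such
  \<open>n\<close> serves all words of length \<open>n\<close> at once.\<close>

lemma upper_local_entropy_less_imp:
  fixes \<mu> :: "'a::metric_space measure"
  assumes "finite_measure \<mu>" and sets: "sets \<mu> = sets borel"
    and cont: "\<And>i. i \<in> {1..m} \<Longrightarrow> continuous_on UNIV (f i)"
    and less: "upper_local_entropy \<mu> m f x < ereal s" and "\<epsilon> > 0"
  shows "\<exists>n\<ge>N. \<forall>C\<in>words m. length C = n \<longrightarrow> exp (- s * real n) \<le> measure \<mu> (bowen_ball f x C \<epsilon>)"
proof -
  interpret finite_measure \<mu> by fact
  define g where "g \<epsilon> n = (SUP C\<in>{C \<in> words m. length C = n}.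
         log_inv (measure \<mu> (bowen_ball f x C \<epsilon>)) / ereal (real n))" for \<epsilon> n
  have "g b n \<le> g a n" if "a \<le> b" for a b n
    unfolding g_def
  proof (rule SUP_mono, rule bexI)
    fix C assume C: "C \<in> {C \<in> words m. length C = n}"
    then have "bowen_ball f x C b \<in> sets \<mu>"
      unfolding sets using cont by (intro borel_open open_bowen_ball[of "{1..m}"]) (auto simp: words_def)
    then have "measure \<mu> (bowen_ball f x C a) \<le> measure \<mu> (bowen_ball f x C b)"
      using bowen_ball_mono[OF that] by (intro finite_measure_mono)
    \<comment> \<open>At \<open>n = 0\<close> there are no words and both suprema are over the empty
      set, so only positive divisors occur.\<close>
    moreover have "n > 0" using C by (auto simp: words_def)
    ultimately show "log_inv (measure \<mu> (bowen_ball f x C b)) / ereal (real n) \<le>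
        log_inv (measure \<mu> (bowen_ball f x C a)) / ereal (real n)"
      by (intro ereal_divide_right_mono log_inv_antimono) auto
  qed
  \<comment> \<open>As a supremum, the local entropy bounds the lower limit at every positive
    radius, in particular at the given \<epsilon>.\<close>
  then have "upper_local_entropy \<mu> m f x = (SUP \<epsilon>\<in>{0<..}. liminf (g \<epsilon>))"
    unfolding upper_local_entropy_def g_def[symmetric]
    by (intro Lim_at_right_0_antimono Liminf_mono) auto
  then have "liminf (g \<epsilon>) < ereal s"
    using less SUP_upper[of \<epsilon> "{0<..}" "\<lambda>\<epsilon>. liminf (g \<epsilon>)"] \<open>\<epsilon> > 0\<close>
    by (metis greaterThan_iff le_less_trans)
  then have "\<not> (\<forall>\<^sub>F n in sequentially. ereal s \<le> g \<epsilon> n)"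
    using Liminf_bounded[of "ereal s" "g \<epsilon>" sequentially] by auto
  then obtain n where n: "n \<ge> N" "g \<epsilon> n < ereal s"
    unfolding eventually_sequentially by (meson not_le)
  have "exp (- s * real n) \<le> measure \<mu> (bowen_ball f x C \<epsilon>)" if "C \<in> words m" "length C = n" for C
  proof (rule log_inv_div_le_imp)
    have "log_inv (measure \<mu> (bowen_ball f x C \<epsilon>)) / ereal (real n) \<le> g \<epsilon> n"
      unfolding g_def using that by (intro SUP_upper) auto
    then show "log_inv (measure \<mu> (bowen_ball f x C \<epsilon>)) / ereal (real n) \<le> ereal s"
      using n(2) by simp
  qed (use that in \<open>auto simp: words_def\<close>)
  with n(1) show ?thesis by blast
qed

text \<open>Choosing the disjoint families inside the level sets of \<open>t\<close> keeps the
  centres in \<open>Y\<close>, as covers along \<omega> require, and lets \<open>t\<close> itself be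
  the order function of the cover.\<close>

lemma M_along_le_geometric_tail:
  fixes \<mu> :: "'a::metric_space measure"
  assumes "prob_space \<mu>" and sets: "sets \<mu> = sets borel"
    and cont: "\<And>i. i \<in> {1..m} \<Longrightarrow> continuous_on UNIV (f i)"
    and less: "\<And>x. x \<in> Y \<Longrightarrow> upper_local_entropy \<mu> m f x < ereal s"
    and w: "\<omega> \<in> sequences m" and "\<epsilon> > 0" "s < l" "N \<ge> 1"
  shows "M_along f \<omega> Y l N \<epsilon> \<le> ennreal (exp (s - l) ^ N / (1 - exp (s - l)))"
proof -
  interpret prob_space \<mu> by fact
  define B where "B n x = bowen_ball f x (map \<omega> [0..<n]) (\<epsilon>/2)" for n x
  define Q where "Q x n \<longleftrightarrow> N \<le> n \<and> exp (- s * real n) \<le> prob (B n x)" for x n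
  define t where "t x = (LEAST n. Q x n)" for x
  have set_w: "set (map \<omega> [0..<n]) \<subseteq> {1..m}" for n
    using w by (auto simp: sequences_def)
  have meas: "B n x \<in> events" for n x
    unfolding B_def sets using cont set_w by (intro borel_open open_bowen_ball[of "{1..m}"])
  have "\<exists>n. Q x n" if "x \<in> Y" for x
  proof -
    have "\<exists>n\<ge>N. \<forall>C\<in>words m. length C = n \<longrightarrow>
        exp (- s * real n) \<le> prob (bowen_ball f x C (\<epsilon>/2))"
      using cont less[OF that] \<open>\<epsilon> > 0\<close>
      by (intro upper_local_entropy_less_imp finite_measure_axioms sets) simp_all
    then obtain n where n: "n \<ge> N"
      "\<And>C. C \<in> words m \<Longrightarrow> length C = n \<Longrightarrow> exp (- s * real n) \<le> prob (bowen_ball f x C (\<epsilon>/2))"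
      by blast
    \<comment> \<open>Nonemptiness of the word comes from \<open>n \<ge> N \<ge> 1\<close>.\<close>
    have "map \<omega> [0..<n] \<in> words m"
      using set_w[of n] n(1) \<open>N \<ge> 1\<close> by (auto simp: words_def)
    then show ?thesis using n by (auto simp: Q_def B_def)
  qed
  then have Qt: "Q x (t x)" if "x \<in> Y" for x
    unfolding t_def using that by (meson LeastI_ex)
  have "\<exists>E. finite E \<and> E \<subseteq> {x\<in>Y. t x = k} \<and> real (card E) * exp (- s * real k) \<le> 1 \<and>
      (\<forall>x\<in>{x\<in>Y. t x = k}. \<exists>y\<in>E. B k x \<inter> B k y \<noteq> {})" for k
  proof -
    have "exp (- s * real k) \<le> prob (B k x)" if "x \<in> {x\<in>Y. t x = k}" for x
      using Qt that by (auto simp: Q_def)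
    then show ?thesis by (rule ex_maximal_disjoint_subfamily[OF meas _ exp_gt_zero])
  qed
  then have "\<exists>E. \<forall>k. finite (E k) \<and> E k \<subseteq> {x\<in>Y. t x = k} \<and>
      real (card (E k)) * exp (- s * real k) \<le> 1 \<and>
      (\<forall>x\<in>{x\<in>Y. t x = k}. \<exists>y\<in>E k. B k x \<inter> B k y \<noteq> {})"
    by (intro choice allI)
  then obtain E where all: "\<forall>k. finite (E k) \<and> E k \<subseteq> {x\<in>Y. t x = k} \<and>
      real (card (E k)) * exp (- s * real k) \<le> 1 \<and>
      (\<forall>x\<in>{x\<in>Y. t x = k}. \<exists>y\<in>E k. B k x \<inter> B k y \<noteq> {})"
    by (rule exE)
  have E: "finite (E k)" "E k \<subseteq> {x\<in>Y. t x = k}" "real (card (E k)) * exp (- s * real k) \<le> 1"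
    "\<forall>x\<in>{x\<in>Y. t x = k}. \<exists>y\<in>E k. B k x \<inter> B k y \<noteq> {}" for k
    using spec[OF all, of k] by - (elim conjE, assumption)+
  define \<Gamma> where "\<Gamma> = (\<Union>k. E k)"
  have "countable \<Gamma>" unfolding \<Gamma>_def using E(1) by (intro countable_UN countableI_type countable_finite)
  moreover have "\<Gamma> \<subseteq> Y" using E(2) by (auto simp: \<Gamma>_def)
  moreover have "\<forall>y\<in>\<Gamma>. N \<le> t y" using Qt \<open>\<Gamma> \<subseteq> Y\<close> by (auto simp: Q_def)
  moreover have "Y \<subseteq> (\<Union>y\<in>\<Gamma>. seq_bowen_ball f (t y) y \<omega> \<epsilon>)"
  proof
    fix x assume "x \<in> Y"
    then obtain y where y: "y \<in> E (t x)" "B (t x) x \<inter> B (t x) y \<noteq> {}" using E(4) by blast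
    then have "x \<in> seq_bowen_ball f (t x) y \<omega> \<epsilon>"
      unfolding B_def seq_bowen_ball_def by (intro bowen_ball_of_half_meet)
    \<comment> \<open>The cover uses the ball at \<open>y\<close> of order \<open>t y\<close>; both
      points lie in the same level, so this is the ball just shown to contain
      \<open>x\<close>.\<close>
    moreover have "t y = t x" using y(1) E(2) by blast
    ultimately show "x \<in> (\<Union>y\<in>\<Gamma>. seq_bowen_ball f (t y) y \<omega> \<epsilon>)"
      using y(1) by (intro UN_I[of y]) (auto simp: \<Gamma>_def)
  qed
  ultimately have "M_along f \<omega> Y l N \<epsilon> \<le> (\<Sum>\<^sub>\<infinity>y\<in>\<Gamma>. ennreal (exp (- l * real (t y))))"
    unfolding M_along_def by (intro Inf_lower) blast
  also have "\<dots> \<le> ennreal (exp (s - l) ^ N / (1 - exp (s - l)))"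
  proof (rule infsum_levels_le[OF E(1) E(3)])
    fix y assume "y \<in> \<Gamma>"
    moreover from this obtain k where "y \<in> E k" by (auto simp: \<Gamma>_def)
    moreover from this have "t y = k" using E(2) by blast
    ultimately show "y \<in> E (t y) \<and> N \<le> t y"
      using \<open>\<forall>y\<in>\<Gamma>. N \<le> t y\<close> by blast
  qed fact
  finally show ?thesis .
qed

lemma M_along_tendsto_0:
  fixes \<mu> :: "'a::metric_space measure"
  assumes "prob_space \<mu>" and "sets \<mu> = sets borel"
    and "\<And>i. i \<in> {1..m} \<Longrightarrow> continuous_on UNIV (f i)"
    and le: "\<And>x. x \<in> Y \<Longrightarrow> upper_local_entropy \<mu> m f x \<le> ereal \<alpha>"
    and "\<omega> \<in> sequences m" and "\<epsilon> > 0" "\<alpha> < l"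
  shows "(\<lambda>N. M_along f \<omega> Y l N \<epsilon>) \<longlonglongrightarrow> 0"
proof -
  \<comment> \<open>The gap above \<alpha> makes the entropy bound strict; the gap below
    \<open>l\<close> makes the ratio \<open>exp (s - l)\<close> less than 1.\<close>
  obtain s where s: "\<alpha> < s" "s < l" using \<open>\<alpha> < l\<close> dense by blast
  have "upper_local_entropy \<mu> m f x < ereal s" if "x \<in> Y" for x
    using le[OF that] s(1) by (simp add: le_less_trans)
  then have "M_along f \<omega> Y l N \<epsilon> \<le> ennreal (exp (s - l) ^ N / (1 - exp (s - l)))" if "N \<ge> 1" for N
    using assms s that by (intro M_along_le_geometric_tail[of \<mu> m]) auto
  then have "\<forall>\<^sub>F N in sequentially. M_along f \<omega> Y l N \<epsilon> \<le> ennreal (exp (s - l) ^ N / (1 - exp (s - l)))"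
    unfolding eventually_sequentially by blast
  moreover have "(\<lambda>N. ennreal (exp (s - l) ^ N / (1 - exp (s - l)))) \<longlonglongrightarrow> ennreal (0 / (1 - exp (s - l)))"
    using s(2) by (intro tendsto_ennrealI tendsto_divide LIMSEQ_realpow_zero tendsto_const) auto
  then have "(\<lambda>N. ennreal (exp (s - l) ^ N / (1 - exp (s - l)))) \<longlonglongrightarrow> 0" by simp
  ultimately show ?thesis
    by (rule tendsto_sandwich[OF always_eventually _ tendsto_const, rotated]) simp
qed

theorem theorem6p5:
  fixes \<mu> :: "'a::metric_space measure"
    and f :: "nat \<Rightarrow> 'a \<Rightarrow> 'a"
    and m :: nat
    and \<alpha> :: real
    and Y :: "'a set"
  assumes "compact (UNIV :: 'a set)"
    and "prob_space \<mu>" and "sets \<mu> = sets borel"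
    and "m \<ge> 1"
    and "\<And>i. i \<in> {1..m} \<Longrightarrow> continuous_on UNIV (f i)"
    and "\<alpha> > 0"
    and "\<And>x. x \<in> Y \<Longrightarrow> upper_local_entropy \<mu> m f x \<le> ereal \<alpha>"
  shows "(\<forall>\<omega>\<in>sequences m. entropy_along f \<omega> Y \<le> ereal \<alpha>) \<and>
         amalgamated_entropy m f Y \<le> ereal \<alpha>"
proof
  have tendsto: "(\<lambda>N. M_along f \<omega> Y l N \<epsilon>) \<longlonglongrightarrow> 0"
    if "\<omega> \<in> sequences m" "\<alpha> < l" "0 < \<epsilon>" for \<omega> l \<epsilon>
    by (rule M_along_tendsto_0[OF assms(2,3,5,7)]) (use that in simp_all)
  show "\<forall>\<omega>\<in>sequences m. entropy_along f \<omega> Y \<le> ereal \<alpha>"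
    unfolding entropy_along_def
    by (intro ballI entropy_of_le M_along_mono_N M_along_antimono_eps tendsto)
  \<comment> \<open>\<open>m \<ge> 1\<close> provides at least one sequence, along which the
    amalgamated cost can be compared.\<close>
  have const: "(\<lambda>_. 1) \<in> sequences m" using assms(4) by (simp add: sequences_def)
  have "(\<lambda>N. M_amalgamated m f Y l N \<epsilon>) \<longlonglongrightarrow> 0" if "\<alpha> < l" "0 < \<epsilon>" for l \<epsilon>
  proof (rule tendsto_sandwich[OF _ _ tendsto_const tendsto[OF const that]])
    \<comment> \<open>The comparison starts at \<open>N = 1\<close>, which is enough for the
      limit.\<close>
    show "\<forall>\<^sub>F N in sequentially. M_amalgamated m f Y l N \<epsilon> \<le> M_along f (\<lambda>_. 1) Y l N \<epsilon>"
      using M_amalgamated_le_M_along[OF const] unfolding eventually_sequentially by blast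
  qed simp
  then show "amalgamated_entropy m f Y \<le> ereal \<alpha>"
    unfolding amalgamated_entropy_def
    by (intro entropy_of_le M_amalgamated_mono_N M_amalgamated_antimono_eps)
qed

end
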